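(* Let $R$ be an associative semiprime ring, let $\alpha : R\to R$ be a ring automorphism, let $D : R\to R$ be an $(\alpha,\alpha)$-symmetric derivation, and let $n$ be a positive integer. Then $[D(x^{n+1}),\alpha(y)] = 0$ for all $x,y\in R$.
   Context: Rings are associative and not assumed to be unital or commutative. $[x,y]$ denotes $xy-yx$. $R$ is semiprime if $aRa = (0)$ implies $a=0$. An additive map $D : R\to R$ is an $(\alpha,\alpha)$-derivation if $D(xy) = D(x)\alpha(y)+\alpha(x)D(y)$ for all $x,y\in R$. An additive $(\alpha,\alpha)$-derivation $D$ is an $(\alpha,\alpha)$-symmetric derivation if $D(xy) = D(yx)$ for all $x,y\in R$. *)

theory Defs
  imports Main "HOL.Modules"
begin

text \<open>
  The class \<^class>\<open>ring\<close> is that of associative rings, neither unital nor commutative;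
  the ring \<open>R\<close> is the whole type.
\<close>

class semiprime_ring = ring +
  assumes semiprime: "range (\<lambda>r. a * r * a) = {0} \<Longrightarrow> a = 0"

text \<open>
  The library's power operation needs a unit, so positive powers are defined here;
  the value at exponent 0 is a dummy.
\<close>

primrec ring_pow :: "'a::ring \<Rightarrow> nat \<Rightarrow> 'a" where
  "ring_pow x 0 = 0"
| "ring_pow x (Suc n) = (if n = 0 then x else ring_pow x n * x)"

definition commutator :: "'a::ring \<Rightarrow> 'a \<Rightarrow> 'a" where
  "commutator x y = x * y - y * x"

definition ring_automorphism :: "('a::ring \<Rightarrow> 'a) \<Rightarrow> bool" where
  "ring_automorphism \<alpha> \<longleftrightarrow> bij \<alpha> \<and> Modules.additive \<alpha> \<and> (\<forall>x y. \<alpha> (x * y) = \<alpha> x * \<alpha> y)"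

text \<open>The \<open>(\<alpha>,\<alpha>)\<close>-derivations; the twisting map \<open>\<alpha>\<close> is the first argument.\<close>

definition twisted_derivation :: "('a::ring \<Rightarrow> 'a) \<Rightarrow> ('a \<Rightarrow> 'a) \<Rightarrow> bool" where
  "twisted_derivation \<alpha> D \<longleftrightarrow>
     Modules.additive D \<and> (\<forall>x y. D (x * y) = D x * \<alpha> y + \<alpha> x * D y)"

definition symmetric_derivation :: "('a::ring \<Rightarrow> 'a) \<Rightarrow> ('a \<Rightarrow> 'a) \<Rightarrow> bool" where
  "symmetric_derivation \<alpha> D \<longleftrightarrow>
     twisted_derivation \<alpha> D \<and> (\<forall>x y. D (x * y) = D (y * x))"

end

theory Submission
  imports Defs
begin

text \<open>
  Every value of \<open>D\<close> is central. Since \<open>D\<close> vanishes on commutators, applying it to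
  \<open>[x, x y] = x [x, y]\<close> gives \<open>D(x) [\<alpha>(x), \<alpha>(y)] = 0\<close>; as \<open>\<alpha>\<close> is onto, replacing \<open>y\<close> by a
  product gives \<open>D(x) R [\<alpha>(x), R] = 0\<close>. By linearization and semiprimeness
  \<open>D(x) R [R, R] = 0\<close>, so that \<open>[D(x), t] R [D(x), t] = 0\<close>, whence \<open>[D(x), t] = 0\<close>.
\<close>

lemma semiprime_zeroI:
  fixes a :: "'a::semiprime_ring"
  assumes "\<And>r. a * r * a = 0"
  shows "a = 0"
  using assms by (intro semiprime) auto

text \<open>Sandwiching any \<open>s\<close> between two copies of \<open>b * r * a\<close> puts the
  factor \<open>a * s * b\<close>, which is zero, in the middle.\<close>

lemma semiprime_annihilator_sym:
  fixes a b :: "'a::semiprime_ring"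
  assumes "\<And>r. a * r * b = 0"
  shows "b * r * a = 0"
proof (rule semiprime_zeroI)
  fix s
  have "b * r * a * s * (b * r * a) = b * r * (a * s * b) * r * a"
    by (simp only: mult.assoc)
  then show "b * r * a * s * (b * r * a) = 0"
    using assms by simp
qed

lemma commutator_mult_right:
  "commutator x (y * z) = commutator x y * z + y * commutator x (z::'a::ring)"
  by (simp add: commutator_def algebra_simps)

lemma commutator_add_left:
  "commutator (x + y) z = commutator x z + commutator y (z::'a::ring)"
  by (simp add: commutator_def algebra_simps)

lemma symmetric_derivation_mult_commutator:
  fixes \<alpha> D :: "'a::ring \<Rightarrow> 'a"
  assumes \<alpha>: "ring_automorphism \<alpha>" and D: "symmetric_derivation \<alpha> D"
  shows "D x * commutator (\<alpha> x) t = 0"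
proof -
  have addD: "Modules.additive D" and add\<alpha>: "Modules.additive \<alpha>"
    and mult\<alpha>: "\<And>u v. \<alpha> (u * v) = \<alpha> u * \<alpha> v"
    and prodD: "\<And>u v. D (u * v) = D u * \<alpha> v + \<alpha> u * D v"
    and symD: "\<And>u v. D (u * v) = D (v * u)"
    using \<alpha> D
    by (auto simp: ring_automorphism_def symmetric_derivation_def twisted_derivation_def)
  obtain y where y: "t = \<alpha> y"
    using \<alpha> by (metis ring_automorphism_def bij_pointE)
  have comm: "D (u * v - v * u) = 0" for u v
    using symD[of u v] by (simp add: additive.diff[OF addD])
  have "0 = D (x * (x * y) - (x * y) * x)"
    by (simp only: comm)
  also have "\<dots> = D (x * (x * y - y * x))"
    by (simp add: algebra_simps)
  \<comment> \<open>The other term of the product rule,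
    \<open>\<alpha> x * D (x * y - y * x)\<close>, drops out because \<open>D\<close> kills
    commutators.\<close>
  also have "\<dots> = D x * \<alpha> (x * y - y * x)"
    by (simp add: prodD[of x] comm)
  also have "\<dots> = D x * commutator (\<alpha> x) t"
    by (simp add: y commutator_def additive.diff[OF add\<alpha>] mult\<alpha>)
  finally show ?thesis
    by simp
qed

text \<open>Semiprimeness needs an arbitrary middle factor. Putting \<open>s * t\<close> for
  \<open>t\<close> in the previous identity supplies it, since
  \<open>commutator (\<alpha> x)\<close> is itself a derivation.\<close>

lemma symmetric_derivation_mult_mult_commutator:
  fixes \<alpha> D :: "'a::ring \<Rightarrow> 'a"
  assumes "ring_automorphism \<alpha>" and "symmetric_derivation \<alpha> D"
  shows "D x * s * commutator (\<alpha> x) t = 0"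
proof -
  have "D x * commutator (\<alpha> x) (s * t)
      = D x * commutator (\<alpha> x) s * t + D x * s * commutator (\<alpha> x) t"
    by (simp add: commutator_mult_right distrib_left mult.assoc)
  then show ?thesis
    by (simp add: symmetric_derivation_mult_commutator[OF assms])
qed

lemma symmetric_derivation_annihilates_commutators:
  fixes \<alpha> D :: "'a::semiprime_ring \<Rightarrow> 'a"
  assumes \<alpha>: "ring_automorphism \<alpha>" and D: "symmetric_derivation \<alpha> D"
  shows "D x * s * commutator v t = 0"
proof -
  note ann = symmetric_derivation_mult_mult_commutator[OF \<alpha> D]
  obtain w where w: "v = \<alpha> w"
    using \<alpha> by (metis ring_automorphism_def bij_pointE)
  have "D (w + x) * s * commutator (\<alpha> (w + x)) t = 0"
    by (rule ann)
  moreover have "D (w + x) = D w + D x" "\<alpha> (w + x) = \<alpha> w + \<alpha> x"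
    using \<alpha> D
    by (auto simp: ring_automorphism_def symmetric_derivation_def twisted_derivation_def
        additive.add)
  \<comment> \<open>Of the four terms in the expansion, the two with matching arguments vanish by
    \<open>ann\<close>; the cross terms must cancel.\<close>
  ultimately have lin: "D x * s * commutator (\<alpha> w) t = - (D w * s * commutator (\<alpha> x) t)"
    by (simp add: commutator_add_left distrib_left distrib_right ann eq_neg_iff_add_eq_0)
  have "D x * s * commutator (\<alpha> w) t = 0"
  proof (rule semiprime_zeroI)
    fix r
    have "commutator (\<alpha> w) t * r * D w = 0"
      by (rule semiprime_annihilator_sym) (rule ann)
    moreover have "D x * s * commutator (\<alpha> w) t * r * (D w * s * commutator (\<alpha> x) t)
        = D x * s * (commutator (\<alpha> w) t * r * D w) * s * commutator (\<alpha> x) t"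
      by (simp only: mult.assoc)
    ultimately have "D x * s * commutator (\<alpha> w) t * r * (D w * s * commutator (\<alpha> x) t) = 0"
      by simp
    \<comment> \<open>Only the right-hand copy is traded for the other cross term, so that
      \<open>D w\<close> meets \<open>commutator (\<alpha> w) t\<close> across
      \<open>r\<close>.\<close>
    then show "D x * s * commutator (\<alpha> w) t * r * (D x * s * commutator (\<alpha> w) t) = 0"
      by (subst (2) lin) simp
  qed
  then show ?thesis
    by (simp add: w)
qed

lemma symmetric_derivation_central:
  fixes \<alpha> D :: "'a::semiprime_ring \<Rightarrow> 'a"
  assumes "ring_automorphism \<alpha>" and "symmetric_derivation \<alpha> D"
  shows "commutator (D x) t = 0"
proof (rule semiprime_zeroI)
  fix r
  let ?c = "commutator (D x) t"
  \<comment> \<open>Only the first \<open>?c\<close> is expanded: the second stays a commutator, and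
    in both terms it is annihilated by \<open>D x\<close> from the left.\<close>
  have "?c * r * ?c = D x * (t * r) * ?c - t * (D x * r * ?c)"
    by (subst (1) commutator_def) (simp only: left_diff_distrib mult.assoc)
  then show "?c * r * ?c = 0"
    by (simp only: symmetric_derivation_annihilates_commutators[OF assms] mult_zero_right diff_self)
qed

theorem theorem3p4:
  fixes \<alpha> D :: "'a::semiprime_ring \<Rightarrow> 'a" and n :: nat
  assumes "ring_automorphism \<alpha>"
    and "symmetric_derivation \<alpha> D"
    and "n > 0"
  shows "\<forall>x y. commutator (D (ring_pow x (n + 1))) (\<alpha> y) = 0"
  using symmetric_derivation_central[OF assms(1,2)] by blast

end
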